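(* The following identity holds for all $0\neq y\in\mathbb C$ with $|\arg y|<\pi/2$: $$e^{y}\,\mathrm{Ei}^+(-y)=\sum_{m=1}^\infty\frac{(-1)^{m+1}\,e\,\Gamma(m)}{(e-1)^m\,(y)_m}-\sum_{k=1}^\infty\sum_{m=1}^\infty\frac{\Gamma(m)\,e^{2^{-k}}}{\left(e^{2^{-k}}+1\right)^m(2^ky)_m}.$$ In terms of the Lerch transcendent this is the identity $$e^{y}\,\mathrm{Ei}^+(-y)=\Phi(e^{-1},1,y)-\sum_{k=1}^\infty\Phi\left(-e^{-2^{-k}},1,2^ky\right),\qquad |\arg y|<\pi/2 .$$ The remainders are similar to those of the dyadic expansion of $e^{-x}\mathrm{Ei}^+(x)$ in $\mathbb C\setminus-i[0,\infty)$, which are recalled in the context.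
   Context: $(y)_m=y(y+1)\cdots(y+m-1)=\Gamma(y+m)/\Gamma(y)$. $\mathrm{Ei}^+(x)=e^{x}\int_0^{\infty e^{i0-}}\frac{e^{-px}}{1-p}\,dp$ for $\arg x=0^+$ (integral along $e^{i\phi}\mathbb R^+$, $\phi<0$, $|\phi|$ small), and by analytic continuation for other $x$ on the Riemann surface of the logarithm; for $|\arg y|<\pi/2$, $\mathrm{Ei}^+(-y)$ is the value of this continuation at the point $x=-y$ with $|\arg x-\pi|<\pi/2$. $\Phi(z,1,x)$ is the Lerch transcendent, $\Phi(z,1,x)=\int_0^\infty\frac{e^{-xp}}{1-ze^{-p}}\,dp$ for $\Re x>0$, $z\in\mathbb C\setminus[1,\infty)$. Remainders referred to for comparison: with $e_k=e^{i\pi/2^k}$, the dyadic expansion in $\mathbb C\setminus-i[0,\infty)$ is $$e^{-x}\mathrm{Ei}^+(x)=-\sum_{m=1}^n\frac{\Gamma(m)}{2^m\left(\frac x{i\pi}\right)_m}-\rho_{n,0}(x)+\sum_{k=1}^{N-1}\left[\sum_{m=1}^\ell\frac{\Gamma(m)\,e^{-i\pi/2^k}}{\left(1+e^{-i\pi/2^k}\right)^m\left(\frac{2^kx}{i\pi}\right)_m}+\rho_{\ell,k}(x)\right]+R_N(x),$$ where $\rho_{n,0}$ and $\rho_{\ell,k}$ are the remainders from truncating the factorial series (for $k=0$ at $n$ terms, for $k\ge1$ at $\ell$ terms) and $R_N$ is the remainder from truncating the sum over $k$. They satisfy: $\rho_{n,0}(x)=O(2^{-n}n^{-\Im x/\pi})$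 for fixed $x$ and large $n$, and $O(x^{-n})$ for fixed $n$ and large $x$; $\rho_{\ell,k}(x)=O(|1+e_k^{-1}|^{-\ell}\ell^{-2^k\Im x/\pi})$ for fixed $k$, $x$ and large $\ell$, and $O((2^kx)^{-\ell})$ for fixed $\ell$ and large $2^kx$; and, for fixed $c>0$, fixed $x$ with $\Re(x/\pi i)>c$ and large $N$, $|R_N(x)|\le\frac1{c_0\,2^{N-1}\Re(x/\pi i)}$ with a constant $c_0>0$, similar estimates holding for $\Re(xe^{-i\pi}/\pi)>c$ and for $\Re(x/\pi)>c$.
   Formalization: Both displayed identities are proved with an overall minus sign on the right-hand side: for the given Ei⁺, e^y Ei⁺(−y) = −∫₀^∞ e^{−yq}/(1+q) dq is negative for y > 0, while the printed right-hand sides equal +∫₀^∞ e^{−yq}/(1+q) dq. *)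

theory Defs
  imports "HOL-Analysis.Analysis" "HOL-Library.Landau_Symbols"
begin

definition Ei_plus_ray :: "real \<Rightarrow> complex \<Rightarrow> complex" where
  "Ei_plus_ray \<phi> x = exp x *
     (LBINT t:{0..}. exp (- (of_real t * cis \<phi> * x)) / (1 - of_real t * cis \<phi>) * cis \<phi>)"

text \<open>
  The Riemann surface of the logarithm is identified with the complex plane through the
  global coordinate \<open>w = log x\<close>, so \<open>Im w\<close> is the argument of \<open>x\<close>.
  \<open>Ei_plus w\<close> is the value at \<open>w\<close> of the analytic continuation to the whole
  surface of the integral along rays just below the positive axis, which is prescribed for
  small positive arguments of \<open>x\<close>.
\<close>

definition Ei_plus :: "complex \<Rightarrow> complex" where
  "Ei_plus = (THE F. F holomorphic_on UNIV \<and>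
     (\<exists>\<delta>>0. \<forall>\<phi> w. - \<delta> < \<phi> \<and> \<phi> < 0 \<and> 0 < Im w \<and> Im w < \<delta> \<longrightarrow>
        F w = Ei_plus_ray \<phi> (exp w)))"

text \<open>
  For \<open>y\<close> in the open right half-plane, \<open>Ln y + i pi\<close> is the point of the surface
  lying over \<open>- y\<close> whose argument is within \<open>pi / 2\<close> of \<open>pi\<close>.  Turning the ray from
  argument \<open>0-\<close> to argument \<open>-pi\<close> meets no pole, so that \<open>exp y * Ei_plus_neg y\<close> is
  minus the integral of \<open>exp (- y * q) / (1 + q)\<close> over \<open>q > 0\<close>; it is negative
  for \<open>y > 0\<close>.
\<close>

definition Ei_plus_neg :: "complex \<Rightarrow> complex" where
  "Ei_plus_neg y = Ei_plus (Ln y + \<i> * of_real pi)"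

text \<open>The Lerch transcendent with second parameter 1, for \<open>Re x > 0\<close> and \<open>z\<close> off \<open>[1, \<infinity>)\<close>.\<close>

definition Lerch_Phi1 :: "complex \<Rightarrow> complex \<Rightarrow> complex" where
  "Lerch_Phi1 z x = (LBINT p:{0..}. exp (- (x * of_real p)) / (1 - z * of_real (exp (- p))))"

definition sector :: "complex set" where
  "sector = {y. y \<noteq> 0 \<and> \<bar>Arg y\<bar> < pi / 2}"

text \<open>The terms below are meant for indices \<open>m \<ge> 1\<close> and \<open>k \<ge> 1\<close>.\<close>

definition term0 :: "nat \<Rightarrow> complex \<Rightarrow> complex" where
  "term0 m y = (-1) ^ (m + 1) * exp 1 * Gamma (of_nat m) / ((exp 1 - 1) ^ m * pochhammer y m)"

definition termk :: "nat \<Rightarrow> nat \<Rightarrow> complex \<Rightarrow> complex" where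
  "termk k m y = Gamma (of_nat m) * exp (1 / 2 ^ k) /
     ((exp (1 / 2 ^ k) + 1) ^ m * pochhammer (2 ^ k * y) m)"

definition series0 :: "complex \<Rightarrow> complex" where
  "series0 y = (\<Sum>m. term0 (Suc m) y)"

definition seriesk :: "nat \<Rightarrow> complex \<Rightarrow> complex" where
  "seriesk k y = (\<Sum>m. termk k (Suc m) y)"

definition rho0 :: "nat \<Rightarrow> complex \<Rightarrow> complex" where
  "rho0 n y = series0 y - (\<Sum>m=1..n. term0 m y)"

definition rhok :: "nat \<Rightarrow> nat \<Rightarrow> complex \<Rightarrow> complex" where
  "rhok l k y = seriesk k y - (\<Sum>m=1..l. termk k m y)"

definition RN :: "nat \<Rightarrow> complex \<Rightarrow> complex" where
  "RN N y = (\<Sum>k. seriesk (Suc k) y) - (\<Sum>k=1..<N. seriesk k y)"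

end

theory Submission
  imports Defs "HOL-Complex_Analysis.Complex_Analysis"
begin

text \<open>
  Everything is a Laplace transform \<open>laplace g s = \<integral> exp (- t s) g t dt\<close> over the positive half-line.

  Turning the ray of integration in the definition of \<open>Ei_plus\<close> to the negative axis gives
  \<open>exp y * Ei_plus_neg y = - laplace (\<lambda>t. 1 / (1 + t)) y\<close>.  The identity is the Laplace transform, at
  \<open>v = 1 + t\<close>, of the dyadic partial fraction
  \<open>1 / v = 1 / (1 - exp (- v)) - (\<Sum>k\<ge>1. 2\<^sup>-\<^sup>k / (1 + exp (- v / 2 ^ k)))\<close>,
  which results from iterating \<open>2 / (1 - q\<^sup>2) = 1 / (1 - q) + 1 / (1 + q)\<close>.  After the substitution
  \<open>t \<mapsto> 2 ^ k * t\<close> each term on the right becomes a Lerch transcendent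
  (\<open>dyadic_Lerch_sums\<close>).

  The factorial series of a Lerch transcendent comes from expanding \<open>1 / (1 - z u)\<close>, \<open>u = exp (- t)\<close>,
  in powers of \<open>1 - u\<close>.  This is a geometric series with ratio \<open>- z (1 - u) / (1 - z)\<close>, and
  \<open>laplace ((1 - u) ^ m) s = m! / (s)\<^sub>m\<^sub>+\<^sub>1\<close> is a Beta integral.  The ratio has modulus below 1 for
  \<open>z < 1 / 2\<close>, which covers \<open>z = exp (- 1)\<close> and all the negative values
  \<open>z = - exp (- 1 / 2 ^ k)\<close>.

  In both steps the partial sums telescope: consecutive remainders, written as Laplace transforms of
  explicit bounded functions, differ by exactly one term, so that it is enough to see that the
  remainders tend to 0.  No interchange of sum and integral occurs.

  That the ray integrals do fit together to one entire function on the logarithmic surface is proved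
  without rotating contours (\<open>ex_entire_extension_of_rays\<close>): each of them has derivative
  \<open>exp (exp w)\<close>, and any two of them tend to 0 along a common horizontal line, so they agree.

  The remainder estimates rest on the factorial series alone: its coefficients decay geometrically,
  and \<open>m! / (s)\<^sub>m\<^sub>+\<^sub>1\<close> is bounded by \<open>n! / \<bar>s\<bar> ^ (n + 1)\<close> for \<open>m \<ge> n\<close>, uniformly in the right
  half-plane, and by a multiple of \<open>m powr (- Re s)\<close> for fixed \<open>s\<close>.
\<close>

section \<open>Laplace transforms\<close>

definition laplace :: "(real \<Rightarrow> complex) \<Rightarrow> complex \<Rightarrow> complex" where
  "laplace g s = (LBINT t:{0..}. exp (- (of_real t * s)) * g t)"

lemma exp_decay_integral:
  fixes a :: real
  assumes "a > 0"
  shows "set_integrable lborel {0..} (\<lambda>t. exp (- (a * t)))"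
    and "(LBINT t:{0..}. exp (- (a * t))) = 1 / a"
proof -
  have lim: "((\<lambda>t. - exp (- (a * t)) / a) \<longlongrightarrow> 0) at_top"
    using assms by real_asymp
  have nn: "(\<integral>\<^sup>+ t. ennreal (exp (- (a * t))) * indicator {0..} t \<partial>lborel) = ennreal (0 - (- exp (- (a * 0)) / a))"
  proof (rule nn_integral_FTC_atLeast[OF _ _ _ lim])
    fix x :: real
    show "((\<lambda>t. - exp (- (a * t)) / a) has_real_derivative exp (- (a * x))) (at x)"
      using assms by (auto intro!: derivative_eq_intros simp: field_simps)
  qed auto
  have eq: "(\<lambda>t. ennreal (exp (- (a * t))) * indicator {0..} t) =
        (\<lambda>t. ennreal (indicator {0..} t *\<^sub>R exp (- (a * t))))"
    by (auto simp: indicator_def fun_eq_iff)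
  have "has_bochner_integral lborel (\<lambda>t. indicator {0..} t *\<^sub>R exp (- (a * t))) (1 / a)"
    by (rule has_bochner_integral_nn_integral) (use nn assms in \<open>simp_all add: eq\<close>)
  then show "set_integrable lborel {0..} (\<lambda>t. exp (- (a * t)))"
    and "(LBINT t:{0..}. exp (- (a * t))) = 1 / a"
    unfolding set_integrable_def set_lebesgue_integral_def
    by (simp_all add: has_bochner_integral_iff)
qed

text \<open>An exponentially growing bound is allowed because the derivative of a Laplace transform brings in
  factors of \<open>t\<close> and \<open>t\<^sup>2\<close>, which are absorbed into \<open>exp (a * t)\<close> with a small \<open>a > 0\<close>.\<close>

lemma laplace_integrable:
  assumes [measurable]: "g \<in> borel_measurable borel"
    and bound: "\<And>t. t \<ge> 0 \<Longrightarrow> norm (g t) \<le> M * exp (a * t)" and a: "a < Re s"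
  shows "set_integrable lborel {0..} (\<lambda>t. exp (- (of_real t * s)) * g t)"
proof (rule set_integrable_bound)
  show "set_integrable lborel {0..} (\<lambda>t. M * exp (- ((Re s - a) * t)))"
    using exp_decay_integral(1)[of "Re s - a"] a by simp
  show "set_borel_measurable lborel {0..} (\<lambda>t. exp (- (of_real t * s)) * g t)"
    unfolding set_borel_measurable_def by measurable
  show "AE t in lborel. t \<in> {0..} \<longrightarrow>
      norm (exp (- (of_real t * s)) * g t) \<le> norm (M * exp (- ((Re s - a) * t)))"
  proof (intro AE_I2 impI)
    fix t :: real assume "t \<in> {0..}"
    then have "norm (exp (- (of_real t * s)) * g t) \<le> exp (- (t * Re s)) * (M * exp (a * t))"
      by (auto simp: norm_mult intro!: mult_left_mono bound)
    also have "\<dots> = M * exp (- ((Re s - a) * t))"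
      by (simp add: algebra_simps exp_add[symmetric])
    finally show "norm (exp (- (of_real t * s)) * g t) \<le> norm (M * exp (- ((Re s - a) * t)))"
      by simp
  qed
qed

lemma norm_laplace_le:
  assumes [measurable]: "g \<in> borel_measurable borel"
    and bound: "\<And>t. t \<ge> 0 \<Longrightarrow> norm (g t) \<le> M * exp (a * t)" and a: "a < Re s"
  shows "norm (laplace g s) \<le> M / (Re s - a)"
proof -
  have int: "set_integrable lborel {0..} (\<lambda>t. exp (- (of_real t * s)) * g t)"
    by (rule laplace_integrable[OF assms])
  have "norm (laplace g s) \<le> (LBINT t:{0..}. norm (exp (- (of_real t * s)) * g t))"
    unfolding laplace_def by (rule set_integral_norm_bound[OF int])
  also have "\<dots> \<le> (LBINT t:{0..}. M * exp (- ((Re s - a) * t)))"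
  proof (rule set_integral_mono)
    show "set_integrable lborel {0..} (\<lambda>t. norm (exp (- (of_real t * s)) * g t))"
      using int by (rule set_integrable_norm)
    show "set_integrable lborel {0..} (\<lambda>t. M * exp (- ((Re s - a) * t)))"
      using exp_decay_integral(1)[of "Re s - a"] a by simp
    fix t :: real assume "t \<in> {0..}"
    then have "norm (exp (- (of_real t * s)) * g t) \<le> exp (- (t * Re s)) * (M * exp (a * t))"
      by (auto simp: norm_mult intro!: mult_left_mono bound)
    also have "\<dots> = M * exp (- ((Re s - a) * t))"
      by (simp add: algebra_simps exp_add[symmetric])
    finally show "norm (exp (- (of_real t * s)) * g t) \<le> M * exp (- ((Re s - a) * t))" .
  qed
  also have "\<dots> = M / (Re s - a)"
    using exp_decay_integral(2)[of "Re s - a"] a by simp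
  finally show ?thesis .
qed

lemma laplace_add:
  assumes "set_integrable lborel {0..} (\<lambda>t. exp (- (of_real t * s)) * f t)"
    and "set_integrable lborel {0..} (\<lambda>t. exp (- (of_real t * s)) * g t)"
  shows "laplace (\<lambda>t. f t + g t) s = laplace f s + laplace g s"
  using set_integral_add(2)[OF assms] by (simp add: laplace_def algebra_simps)

lemma laplace_diff:
  assumes "set_integrable lborel {0..} (\<lambda>t. exp (- (of_real t * s)) * f t)"
    and "set_integrable lborel {0..} (\<lambda>t. exp (- (of_real t * s)) * g t)"
  shows "laplace (\<lambda>t. f t - g t) s = laplace f s - laplace g s"
  using set_integral_diff(2)[OF assms] by (simp add: laplace_def algebra_simps)

lemma laplace_cmult: "laplace (\<lambda>t. c * g t) s = c * laplace g s"
  by (simp add: laplace_def mult.left_commute)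

lemma laplace_cong: "(\<And>t. t \<ge> 0 \<Longrightarrow> f t = g t) \<Longrightarrow> laplace f s = laplace g s"
  unfolding laplace_def by (rule set_lebesgue_integral_cong) auto

lemma laplace_shift: "laplace (\<lambda>t. of_real (exp (- t)) * g t) s = laplace g (s + 1)"
  unfolding laplace_def
  by (rule set_lebesgue_integral_cong)
     (auto simp: algebra_simps exp_add exp_minus exp_diff exp_of_real divide_simps)

lemma laplace_scale:
  assumes "a > 0"
  shows "laplace (\<lambda>t. g (t / a)) s = of_real a * laplace g (of_real a * s)"
proof -
  let ?f = "\<lambda>t. indicator {0..} t *\<^sub>R (exp (- (of_real t * s)) * g (t / a))"
  have "laplace (\<lambda>t. g (t / a)) s = integral\<^sup>L lborel ?f"
    by (simp add: laplace_def set_lebesgue_integral_def)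
  also have "\<dots> = \<bar>a\<bar> *\<^sub>R (LBINT t. ?f (0 + a * t))"
    by (rule lborel_integral_real_affine) (use assms in simp)
  also have "(\<lambda>t. ?f (0 + a * t)) =
      (\<lambda>t. indicator {0..} t *\<^sub>R (exp (- (of_real t * (of_real a * s))) * g t))"
    using assms by (auto simp: indicator_def fun_eq_iff zero_le_mult_iff mult_ac)
  finally show ?thesis
    using assms by (simp add: laplace_def set_lebesgue_integral_def scaleR_conv_of_real)
qed

lemma laplace_const:
  assumes "Re s > 0"
  shows "laplace (\<lambda>t. c) s = c / s"
proof -
  have s0: "s \<noteq> 0" using assms by auto
  have int: "set_integrable lborel {0..} (\<lambda>t. exp (- (of_real t * s)))"
    using laplace_integrable[of "\<lambda>_. 1" 1 0 s] assms by simp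
  let ?F = "\<lambda>t::real. - exp (- (of_real t * s)) / s"
  have "(LBINT t=ereal 0..\<infinity>. exp (- (of_real t * s))) = 0 - (- 1 / s)"
  proof (rule interval_integral_FTC_integrable[where F = ?F])
    show "(?F has_vector_derivative exp (- (of_real x * s))) (at x)" for x
      using s0 by (auto intro!: derivative_eq_intros has_vector_derivative_real_field simp: field_simps)
    show "isCont (\<lambda>x. exp (- (of_real x * s))) x" for x
      by (intro continuous_intros)
    show "set_integrable lborel (einterval (ereal 0) \<infinity>) (\<lambda>t. exp (- (of_real t * s)))"
      by (rule set_integrable_subset[OF int]) (auto simp: einterval_def)
    have "(?F \<longlongrightarrow> ?F 0) (at_right 0)"
      by (intro tendsto_intros) (use s0 in auto)
    then show "((?F \<circ> real_of_ereal) \<longlongrightarrow> - 1 / s) (at_right (ereal 0))"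
      by (simp add: ereal_tendsto_simps)
    have "(?F \<longlongrightarrow> 0) at_top"
    proof (rule tendsto_norm_zero_cancel)
      have "((\<lambda>t. exp (- (t * Re s)) / norm s) \<longlongrightarrow> 0) at_top"
        using assms s0 by real_asymp
      then show "((\<lambda>t. norm (?F t)) \<longlongrightarrow> 0) at_top"
        by (simp add: norm_divide)
    qed
    then show "((?F \<circ> real_of_ereal) \<longlongrightarrow> 0) (at_left \<infinity>)"
      by (simp add: ereal_tendsto_simps)
  qed auto
  moreover have "(LBINT t=ereal 0..\<infinity>. exp (- (of_real t * s))) = (LBINT t:{0<..}. exp (- (of_real t * s)))"
    by (rule interval_integral_to_infinity_eq)
  moreover have "(LBINT t:{0<..}. exp (- (of_real t * s))) = (LBINT t:{0..}. exp (- (of_real t * s)))"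
    unfolding set_lebesgue_integral_def
    by (rule integral_cong_AE, measurable) (use AE_lborel_singleton[of 0] in eventually_elim; simp add: indicator_def)
  ultimately have "laplace (\<lambda>t. 1) s = 1 / s"
    by (simp add: laplace_def)
  then show ?thesis
    using laplace_cmult[of c "\<lambda>_. 1" s] by simp
qed

lemma quadratic_le_exp:
  fixes a t :: real
  assumes "a > 0" "t \<ge> 0"
  shows "t\<^sup>2 \<le> 2 / a\<^sup>2 * exp (a * t)"
proof -
  have "(a * t)\<^sup>2 / 2 \<le> exp (a * t)"
    using exp_lower_Taylor_quadratic[of "a * t"] assms by (smt (verit) mult_nonneg_nonneg)
  then show ?thesis using assms by (simp add: field_simps power2_eq_square)
qed

lemma linear_le_exp:
  fixes a t :: real
  assumes "a > 0"
  shows "t \<le> 1 / a * exp (a * t)"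
proof -
  have "a * t \<le> exp (a * t)" using exp_ge_add_one_self[of "a * t"] by linarith
  then show ?thesis using assms by (simp add: field_simps)
qed

lemma laplace_moment_integrable:
  assumes [measurable]: "g \<in> borel_measurable borel"
    and bound: "\<And>t. t \<ge> 0 \<Longrightarrow> norm (g t) \<le> M" and s: "Re s > 0"
  shows "set_integrable lborel {0..} (\<lambda>t. exp (- (of_real t * s)) * (- of_real t * g t))"
proof (rule laplace_integrable[where M = "M / (Re s / 2)" and a = "Re s / 2"])
  fix t :: real assume t: "t \<ge> 0"
  have "norm (- of_real t * g t) = t * norm (g t)" using t by (simp add: norm_mult)
  also have "\<dots> \<le> (1 / (Re s / 2) * exp (Re s / 2 * t)) * M"
    using linear_le_exp[of "Re s / 2" t] bound[OF t] t s by (intro mult_mono) auto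
  finally show "norm (- of_real t * g t) \<le> M / (Re s / 2) * exp (Re s / 2 * t)" by (simp add: mult_ac)
qed (use s in auto)

text \<open>The second-order Taylor remainder of \<open>exp (- t h)\<close> is at most \<open>t\<^sup>2 \<bar>h\<bar>\<^sup>2 exp (t \<bar>h\<bar>)\<close>.  Integrated
  against the kernel this is \<open>O(\<bar>h\<bar>\<^sup>2)\<close> as long as \<open>\<bar>h\<bar>\<close> is a fixed fraction of \<open>Re s\<close>.\<close>

lemma laplace_has_field_derivative:
  assumes meas[measurable]: "g \<in> borel_measurable borel"
    and bound: "\<And>t. t \<ge> 0 \<Longrightarrow> norm (g t) \<le> M" and s: "Re s > 0"
  shows "(laplace g has_field_derivative laplace (\<lambda>t. - of_real t * g t) s) (at s)"
proof -
  define \<sigma> where "\<sigma> = Re s"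
  define K where "K = M * (2 / (\<sigma> / 4)\<^sup>2) / (\<sigma> / 2)"
  have \<sigma>: "\<sigma> > 0" using s by (simp add: \<sigma>_def)
  have M: "M \<ge> 0" using bound[of 0] norm_ge_zero[of "g 0"] by linarith
  have int_g: "set_integrable lborel {0..} (\<lambda>t. exp (- (of_real t * z)) * g t)" if "Re z > 0" for z
    by (rule laplace_integrable[where M = M and a = 0]) (use bound that in auto)
  note int_tg = laplace_moment_integrable[OF assms]
  \<comment> \<open>Two factors \<open>exp (\<sigma> t / 4)\<close>, one from \<open>exp (t \<bar>h\<bar>)\<close> and one from \<open>t\<^sup>2\<close>, leave half of the decay.\<close>
  have key: "norm (laplace g (s + h) - laplace g s - h * laplace (\<lambda>t. - of_real t * g t) s) \<le> K * (norm h)\<^sup>2"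
    if h: "norm h \<le> \<sigma> / 4" for h
  proof -
    define r where "r t = (exp (- (of_real t * h)) - 1 - of_real t * - h) * g t" for t :: real
    have [measurable]: "r \<in> borel_measurable borel" unfolding r_def by measurable
    have pos: "Re (s + h) > 0"
      using abs_Re_le_cmod[of h] h \<sigma> by (auto simp: \<sigma>_def)
    have "laplace g (s + h) - laplace g s - h * laplace (\<lambda>t. - of_real t * g t) s
        = (LBINT t:{0..}. exp (- (of_real t * (s + h))) * g t - exp (- (of_real t * s)) * g t
             - h * (exp (- (of_real t * s)) * (- of_real t * g t)))"
      unfolding laplace_def
      using int_g[OF pos] int_g[OF s] set_integrable_mult_right[OF int_tg, of h]
      by (simp only: set_integral_diff set_integral_mult_right)
    also have "\<dots> = laplace r s"
      unfolding laplace_def r_def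
      by (rule set_lebesgue_integral_cong) (auto simp: algebra_simps exp_add exp_diff exp_minus divide_simps)
    also have "norm (laplace r s) \<le> ((norm h)\<^sup>2 * (M * (2 / (\<sigma> / 4)\<^sup>2))) / (Re s - \<sigma> / 2)"
    proof (rule norm_laplace_le)
      fix t :: real assume t: "t \<ge> 0"
      define z where "z = - (of_real t * h)"
      have nz: "norm z = t * norm h" using t by (simp add: z_def norm_mult)
      have "norm (exp z - 1 - z) \<le> exp (norm z) * (norm z)\<^sup>2"
        using Taylor_exp_field[of z 1] by (simp add: algebra_simps power2_eq_square)
      also have "\<dots> \<le> exp (\<sigma> / 4 * t) * (norm h ^ 2 * t\<^sup>2)"
        using mult_right_mono[OF h t]
        by (intro mult_mono) (simp_all add: nz power_mult_distrib mult_ac)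
      also have "\<dots> \<le> exp (\<sigma> / 4 * t) * (norm h ^ 2 * (2 / (\<sigma> / 4)\<^sup>2 * exp (\<sigma> / 4 * t)))"
        using quadratic_le_exp[of "\<sigma> / 4" t] t \<sigma> by (intro mult_left_mono) auto
      also have "\<dots> = (norm h)\<^sup>2 * (2 / (\<sigma> / 4)\<^sup>2) * exp (\<sigma> / 2 * t)"
        by (simp add: exp_add[symmetric] mult_ac)
      finally have "norm (exp z - 1 - z) * norm (g t) \<le> ((norm h)\<^sup>2 * (2 / (\<sigma> / 4)\<^sup>2) * exp (\<sigma> / 2 * t)) * M"
        using bound[OF t] by (intro mult_mono) auto
      then show "norm (r t) \<le> (norm h)\<^sup>2 * (M * (2 / (\<sigma> / 4)\<^sup>2)) * exp (\<sigma> / 2 * t)"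
        by (simp add: r_def norm_mult z_def mult_ac)
    qed (use \<sigma> in \<open>auto simp: \<sigma>_def\<close>)
    also have "\<dots> = K * (norm h)\<^sup>2" by (simp add: K_def \<sigma>_def mult_ac)
    finally show ?thesis .
  qed
  show ?thesis
    unfolding DERIV_def
  proof (rule Lim_transform2, rule tendsto_const)
    have "\<forall>\<^sub>F h in at 0. norm h \<le> \<sigma> / 4 \<and> h \<noteq> (0::complex)"
      unfolding eventually_at using \<sigma> by (intro exI[of _ "\<sigma> / 4"]) auto
    then have ev: "\<forall>\<^sub>F h in at 0. norm ((laplace g (s + h) - laplace g s) / h - laplace (\<lambda>t. - of_real t * g t) s)
                      \<le> K * norm h"
    proof eventually_elim
      case (elim h)
      have "norm ((laplace g (s + h) - laplace g s) / h - laplace (\<lambda>t. - of_real t * g t) s)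
          = norm (laplace g (s + h) - laplace g s - h * laplace (\<lambda>t. - of_real t * g t) s) / norm h"
        using elim by (simp add: norm_divide[symmetric] diff_divide_distrib)
      also have "\<dots> \<le> K * (norm h)\<^sup>2 / norm h"
        using key elim by (intro divide_right_mono) auto
      finally show ?case using elim by (simp add: power2_eq_square)
    qed
    have "((\<lambda>h. K * norm h) \<longlongrightarrow> K * norm (0::complex)) (at (0::complex))"
      by (rule tendsto_mult[OF tendsto_const tendsto_norm[OF tendsto_ident_at]])
    then have "((\<lambda>h. (laplace g (s + h) - laplace g s) / h - laplace (\<lambda>t. - of_real t * g t) s) \<longlongrightarrow> 0) (at 0)"
      by (intro Lim_null_comparison[OF ev]) (simp only: norm_zero mult_zero_right)
    then have "((\<lambda>h. - ((laplace g (s + h) - laplace g s) / h - laplace (\<lambda>t. - of_real t * g t) s)) \<longlongrightarrow> - 0) (at 0)"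
      by (rule tendsto_minus)
    then show "((\<lambda>h. laplace (\<lambda>t. - of_real t * g t) s - (laplace g (s + h) - laplace g s) / h) \<longlongrightarrow> 0) (at 0)"
      by simp
  qed
qed

section \<open>The exponential integral on the logarithmic surface\<close>

text \<open>\<open>\<bar>1 - t exp (\<i> \<phi>)\<bar>\<^sup>2 = cos\<^sup>2 (\<phi> / 2) (1 - t)\<^sup>2 + sin\<^sup>2 (\<phi> / 2) (1 + t)\<^sup>2\<close>, which keeps the ray away
  from the pole at 1, uniformly in \<open>t\<close>, unless \<open>\<phi>\<close> is a multiple of \<open>2 pi\<close>.\<close>

lemma norm_one_minus_ray_ge:
  assumes "t \<ge> 0"
  shows "sqrt ((1 - cos \<phi>) / 2) \<le> norm (1 - of_real t * cis \<phi>)"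
proof -
  have "(1 - t * cos \<phi>)\<^sup>2 + (t * sin \<phi>)\<^sup>2 = 1 - 2 * t * cos \<phi> + t\<^sup>2 * ((cos \<phi>)\<^sup>2 + (sin \<phi>)\<^sup>2)"
    by algebra
  also have "\<dots> = (1 + cos \<phi>) / 2 * (1 - t)\<^sup>2 + (1 - cos \<phi>) / 2 * (1 + t)\<^sup>2"
    by (simp add: power2_eq_square field_simps)
  also have "\<dots> \<ge> 0 + (1 - cos \<phi>) / 2 * 1\<^sup>2"
    using assms by (intro add_mono mult_left_mono mult_nonneg_nonneg power_mono)
      (auto simp: add.commute cos_ge_minus_one minus_le_iff real_0_le_add_iff)
  finally show ?thesis
    by (auto simp: cmod_def intro: real_sqrt_le_mono)
qed

definition ray_kernel :: "real \<Rightarrow> real \<Rightarrow> complex" where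
  "ray_kernel \<phi> t = cis \<phi> / (1 - of_real t * cis \<phi>)"

lemma measurable_ray_kernel [measurable]: "ray_kernel \<phi> \<in> borel_measurable borel"
  unfolding ray_kernel_def by measurable

lemma norm_ray_kernel_le:
  assumes "t \<ge> 0" "cos \<phi> < 1"
  shows "norm (ray_kernel \<phi> t) \<le> 1 / sqrt ((1 - cos \<phi>) / 2)"
proof -
  have "0 < sqrt ((1 - cos \<phi>) / 2)" using assms by simp
  then show ?thesis
    using norm_one_minus_ray_ge[OF assms(1), of \<phi>]
    by (simp add: ray_kernel_def norm_divide frac_le)
qed

lemma Ei_plus_ray_laplace:
  "Ei_plus_ray \<phi> x = exp x * laplace (ray_kernel \<phi>) (cis \<phi> * x)"
  by (simp add: Ei_plus_ray_def laplace_def ray_kernel_def mult.assoc)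

lemma Re_cis_exp: "Re (cis \<phi> * exp w) = exp (Re w) * cos (\<phi> + Im w)"
  by (simp add: Re_exp Im_exp cos_add algebra_simps)

text \<open>With \<open>x = exp w\<close>, \<open>c = exp (\<i> \<phi>)\<close>, the factor \<open>1 - t c\<close> produced by differentiating \<open>exp x * exp (- t c x)\<close>
  in \<open>x\<close> cancels the denominator, and the rest integrates to \<open>exp x / x\<close>.  So the derivative in the
  logarithmic coordinate does not depend on the ray.\<close>

lemma Ei_plus_ray_deriv:
  assumes \<phi>: "cos \<phi> < 1" and w: "\<bar>Im w + \<phi>\<bar> < pi / 2"
  shows "((\<lambda>w. Ei_plus_ray \<phi> (exp w)) has_field_derivative exp (exp w)) (at w)"
proof -
  define c where "c = cis \<phi>"
  define s where "s = c * exp w"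
  define L where "L = laplace (ray_kernel \<phi>)"
  define L' where "L' = laplace (\<lambda>t. - of_real t * ray_kernel \<phi> t) s"
  have s: "Re s > 0"
    unfolding s_def c_def Re_cis_exp by (intro mult_pos_pos cos_gt_zero_pi) (use w in \<open>simp, linarith+\<close>)
  have c0: "c \<noteq> 0" by (simp add: c_def)
  have bound: "norm (ray_kernel \<phi> t) \<le> 1 / sqrt ((1 - cos \<phi>) / 2)" if "t \<ge> 0" for t
    by (rule norm_ray_kernel_le[OF that \<phi>])
  have int: "set_integrable lborel {0..} (\<lambda>t. exp (- (of_real t * s)) * ray_kernel \<phi> t)"
    by (rule laplace_integrable[where M = "1 / sqrt ((1 - cos \<phi>) / 2)" and a = 0]) (use bound s in auto)
  have intm: "set_integrable lborel {0..} (\<lambda>t. exp (- (of_real t * s)) * (c * (- of_real t * ray_kernel \<phi> t)))"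
    using set_integrable_mult_right[OF laplace_moment_integrable[OF _ bound s], of c]
    by (simp add: mult.left_commute)
  have "L s + c * L' = laplace (\<lambda>t. ray_kernel \<phi> t + c * (- of_real t * ray_kernel \<phi> t)) s"
    unfolding laplace_add[OF int intm] laplace_cmult L_def L'_def ..
  also have "\<dots> = laplace (\<lambda>t. c) s"
  proof (rule laplace_cong)
    fix t :: real assume "t \<ge> 0"
    then have "1 - of_real t * c \<noteq> 0"
      using norm_one_minus_ray_ge[of t \<phi>] \<phi> by (auto simp: c_def)
    then show "ray_kernel \<phi> t + c * (- of_real t * ray_kernel \<phi> t) = c"
      by (simp add: ray_kernel_def c_def[symmetric] divide_simps) (simp add: algebra_simps)
  qed
  also have "\<dots> = c / s" by (rule laplace_const[OF s])
  finally have ode: "L s + c * L' = 1 / exp w" using c0 by (simp add: s_def)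
  have dL: "(L has_field_derivative L') (at (c * exp w))"
    using laplace_has_field_derivative[OF _ bound s] by (simp add: L_def L'_def s_def)
  have d1: "((\<lambda>w. L (c * exp w)) has_field_derivative L' * (c * exp w)) (at w)"
    by (rule DERIV_chain2[where g = "\<lambda>w. c * exp w" and x = w, OF dL])
       (auto intro!: derivative_eq_intros)
  have d2: "((\<lambda>w. exp (exp w)) has_field_derivative exp (exp w) * exp w) (at w)"
    by (auto intro!: derivative_eq_intros)
  have "((\<lambda>w. exp (exp w) * L (c * exp w)) has_field_derivative
      exp (exp w) * exp w * L s + L' * (c * exp w) * exp (exp w)) (at w)"
    using DERIV_mult[OF d2 d1] by (simp add: s_def)
  also have "exp (exp w) * exp w * L s + L' * (c * exp w) * exp (exp w) = exp (exp w) * exp w * (L s + c * L')"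
    by (simp add: algebra_simps)
  also have "\<dots> = exp (exp w)" by (simp add: ode)
  finally show ?thesis by (simp add: Ei_plus_ray_laplace L_def c_def)
qed

text \<open>Where \<open>cos \<theta> < 0\<close> the prefactor \<open>exp x\<close> is decaying, and the integral is \<open>O(1 / \<bar>x\<bar>)\<close> by the bound
  on the kernel.\<close>

lemma Ei_plus_ray_tendsto_0:
  assumes \<phi>: "cos \<phi> < 1" and \<theta>: "cos \<theta> < 0" "cos (\<phi> + \<theta>) > 0"
  shows "((\<lambda>r. Ei_plus_ray \<phi> (exp (Complex r \<theta>))) \<longlongrightarrow> 0) at_top"
proof (rule Lim_null_comparison)
  define M where "M = 1 / sqrt ((1 - cos \<phi>) / 2)"
  define a where "a = cos \<theta>"
  define b where "b = cos (\<phi> + \<theta>)"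
  show "((\<lambda>r. exp (exp r * a) * (M / (exp r * b - 0))) \<longlongrightarrow> 0) at_top"
    using \<theta> unfolding a_def[symmetric] b_def[symmetric] by real_asymp
  show "\<forall>\<^sub>F r in at_top. norm (Ei_plus_ray \<phi> (exp (Complex r \<theta>))) \<le> exp (exp r * a) * (M / (exp r * b - 0))"
  proof (rule always_eventually, rule allI)
    fix r :: real
    have "norm (laplace (ray_kernel \<phi>) (cis \<phi> * exp (Complex r \<theta>))) \<le> M / (Re (cis \<phi> * exp (Complex r \<theta>)) - 0)"
      by (rule norm_laplace_le) (use norm_ray_kernel_le[OF _ \<phi>] \<theta> in \<open>auto simp: M_def Re_cis_exp simp del: times_complex.sel\<close>)
    also have "\<dots> = M / (exp r * b - 0)" by (simp only: Re_cis_exp b_def complex.sel)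
    finally have "exp (exp r * a) * norm (laplace (ray_kernel \<phi>) (cis \<phi> * exp (Complex r \<theta>))) \<le> exp (exp r * a) * (M / (exp r * b - 0))"
      by (intro mult_left_mono) auto
    then show "norm (Ei_plus_ray \<phi> (exp (Complex r \<theta>))) \<le> exp (exp r * a) * (M / (exp r * b - 0))"
      by (simp add: Ei_plus_ray_laplace norm_mult Re_exp a_def)
  qed
qed

text \<open>On the strip where the ray integral converges it differs from an entire primitive of
  \<open>exp (exp w)\<close> by a constant.  The primitive is normalized to match the ray \<open>\<phi> = - pi\<close>.  For any other
  \<open>\<phi>\<close>, the line \<open>Im w = pi / 2 - \<phi> / 2\<close> lies in both strips and in the region where
  both ray integrals tend to 0, which forces the two constants to be equal.\<close>

lemma ex_entire_extension_of_rays: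
  "\<exists>F. F holomorphic_on UNIV \<and>
     (\<forall>\<phi>\<in>{-pi..<0}. \<forall>w. \<bar>Im w + \<phi>\<bar> < pi / 2 \<longrightarrow> F w = Ei_plus_ray \<phi> (exp w))"
proof -
  have "(\<lambda>w::complex. exp (exp w)) holomorphic_on UNIV" by (intro holomorphic_intros)
  then obtain F0 :: "complex \<Rightarrow> complex" where F0: "\<And>w. (F0 has_field_derivative exp (exp w)) (at w)"
    using holomorphic_convex_primitive'[of UNIV "\<lambda>w. exp (exp w)"] by auto
  have const: "\<exists>C. \<forall>w. \<bar>Im w + \<phi>\<bar> < pi / 2 \<longrightarrow> Ei_plus_ray \<phi> (exp w) = F0 w + C" if "cos \<phi> < 1" for \<phi>
  proof -
    let ?S = "{w. \<bar>Im w + \<phi>\<bar> < pi / 2}"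
    have "\<bar>x + \<phi>\<bar> < pi / 2 \<longleftrightarrow> x < pi / 2 - \<phi> \<and> - pi / 2 - \<phi> < x" for x
      by linarith
    then have "?S = {w. Im w < pi / 2 - \<phi>} \<inter> {w. Im w > - pi / 2 - \<phi>}"
      by blast
    then have conv: "convex ?S" by (simp add: convex_Int convex_halfspace_Im_lt convex_halfspace_Im_gt)
    have "\<exists>C. \<forall>w\<in>?S. Ei_plus_ray \<phi> (exp w) - F0 w = C"
    proof (rule has_field_derivative_zero_constant[OF conv])
      fix w assume "w \<in> ?S"
      then show "((\<lambda>w. Ei_plus_ray \<phi> (exp w) - F0 w) has_field_derivative 0) (at w within ?S)"
        using DERIV_diff[OF Ei_plus_ray_deriv[OF that, of w] F0[of w]] has_field_derivative_at_within by auto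
    qed
    then show ?thesis by (auto simp: algebra_simps)
  qed
  obtain C0 where C0: "\<And>w. \<bar>Im w + - pi\<bar> < pi / 2 \<Longrightarrow> Ei_plus_ray (- pi) (exp w) = F0 w + C0"
    using const[of "- pi"] by auto
  show ?thesis
  proof (intro exI[of _ "\<lambda>w. F0 w + C0"] conjI ballI allI impI)
    show "(\<lambda>w. F0 w + C0) holomorphic_on UNIV"
      using DERIV_add[OF F0 DERIV_const] by (auto simp: holomorphic_on_open)
    fix \<phi> w assume \<phi>: "\<phi> \<in> {-pi..<0}" and w: "\<bar>Im w + \<phi>\<bar> < pi / 2"
    have cos1: "cos \<phi> < 1"
      using cos_monotone_minus_pi_0[of \<phi> 0] \<phi> by auto
    obtain C where C: "\<And>w. \<bar>Im w + \<phi>\<bar> < pi / 2 \<Longrightarrow> Ei_plus_ray \<phi> (exp w) = F0 w + C"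
      using const[OF cos1] by auto
    define \<theta> where "\<theta> = pi / 2 - \<phi> / 2"
    have range: "pi / 2 < \<theta>" "\<theta> \<le> pi" "0 \<le> \<phi> + \<theta>" "\<phi> + \<theta> < pi / 2"
      using \<phi> by (auto simp: \<theta>_def field_simps)
    have pos: "cos (\<phi> + \<theta>) > 0" "cos (\<theta> - pi) > 0"
      using range pi_gt_zero by (auto intro!: cos_gt_zero_pi simp del: cos_minus_pi)
    then have neg: "cos \<theta> < 0" by (simp add: cos_diff)
    have "((\<lambda>r. Ei_plus_ray \<phi> (exp (Complex r \<theta>)) - Ei_plus_ray (- pi) (exp (Complex r \<theta>))) \<longlongrightarrow> 0 - 0) at_top"
      by (intro tendsto_diff Ei_plus_ray_tendsto_0 cos1 neg pos) (use pos in \<open>auto simp: cos_diff cos_add\<close>)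
    moreover have "Ei_plus_ray \<phi> (exp (Complex r \<theta>)) - Ei_plus_ray (- pi) (exp (Complex r \<theta>)) = C - C0" for r
      using range C[of "Complex r \<theta>"] C0[of "Complex r \<theta>"] by auto
    ultimately have "C - C0 = 0"
      by (simp add: tendsto_const_iff)
    then show "F0 w + C0 = Ei_plus_ray \<phi> (exp w)" using C[OF w] by simp
  qed
qed

text \<open>By uniqueness of analytic continuation the definite description in \<open>Ei_plus\<close> denotes the entire
  function just constructed, which agrees with all rays between the directions \<open>- pi\<close> and \<open>0\<close>, not only
  with those close to \<open>0\<close>.\<close>

lemma Ei_plus_eq_ray:
  assumes "\<phi> \<in> {-pi..<0}" "\<bar>Im w + \<phi>\<bar> < pi / 2"
  shows "Ei_plus w = Ei_plus_ray \<phi> (exp w)"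
proof -
  obtain F where hol: "F holomorphic_on UNIV"
    and F: "\<And>\<phi> w. \<phi> \<in> {-pi..<0} \<Longrightarrow> \<bar>Im w + \<phi>\<bar> < pi / 2 \<Longrightarrow> F w = Ei_plus_ray \<phi> (exp w)"
    using ex_entire_extension_of_rays by blast
  have "Ei_plus = F"
    unfolding Ei_plus_def
  proof (rule the_equality)
    show "F holomorphic_on UNIV \<and> (\<exists>\<delta>>0. \<forall>\<phi> w. - \<delta> < \<phi> \<and> \<phi> < 0 \<and> 0 < Im w \<and> Im w < \<delta> \<longrightarrow>
        F w = Ei_plus_ray \<phi> (exp w))"
    proof (intro conjI exI[of _ "pi / 4"] allI impI F)
      fix \<phi> :: real and w
      assume "- (pi / 4) < \<phi> \<and> \<phi> < 0 \<and> 0 < Im w \<and> Im w < pi / 4"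
      then show "\<phi> \<in> {-pi..<0}" "\<bar>Im w + \<phi>\<bar> < pi / 2"
        using pi_gt_zero by (simp, linarith)+
    qed (use hol in auto)
  next
    fix G assume "G holomorphic_on UNIV \<and> (\<exists>\<delta>>0. \<forall>\<phi> w. - \<delta> < \<phi> \<and> \<phi> < 0 \<and> 0 < Im w \<and> Im w < \<delta> \<longrightarrow>
        G w = Ei_plus_ray \<phi> (exp w))"
    then obtain \<delta> where G: "G holomorphic_on UNIV" "\<delta> > 0"
      and Geq: "\<And>\<phi> w. - \<delta> < \<phi> \<Longrightarrow> \<phi> < 0 \<Longrightarrow> 0 < Im w \<Longrightarrow> Im w < \<delta> \<Longrightarrow> G w = Ei_plus_ray \<phi> (exp w)"
      by blast
    define d where "d = min \<delta> (pi / 4)"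
    have d: "d > 0" "d \<le> \<delta>" "d \<le> pi / 4" using G by (auto simp: d_def)
    let ?U = "{w::complex. 0 < Im w} \<inter> {w. Im w < d}"
    show "G = F"
    proof
      fix z
      show "G z = F z"
      proof (rule analytic_continuation_open[of ?U UNIV G F])
        show "open ?U" by (intro open_Int open_halfspace_Im_gt open_halfspace_Im_lt)
        have "Complex 0 (d / 2) \<in> ?U" using d by simp
        then show "?U \<noteq> {}" by blast
        fix w assume w: "w \<in> ?U"
        have "G w = Ei_plus_ray (- d / 2) (exp w)" using w d by (intro Geq) auto
        also have "\<dots> = F w"
        proof (rule F[symmetric])
          have "0 < Im w" "Im w < d" using w by auto
          then show "\<bar>Im w + - d / 2\<bar> < pi / 2" using d pi_gt_zero by linarith
        qed (use d in auto)
        finally show "G w = F w" .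
      qed (use G hol in auto)
    qed
  qed
  then show ?thesis using F[OF assms] by simp
qed

lemma sector_iff: "y \<in> sector \<longleftrightarrow> Re y > 0"
  using Re_Ln_pos_lt[of y] by (cases "y = 0") (auto simp: sector_def Arg_eq_Im_Ln)

lemma Ei_plus_neg_laplace:
  assumes "Re y > 0"
  shows "exp y * Ei_plus_neg y = - laplace (\<lambda>t. 1 / (1 + of_real t)) y"
proof -
  have y0: "y \<noteq> 0" using assms by auto
  have cis_neg: "cis (- pi) = - 1" by (simp add: complex_eq_iff)
  have "Ei_plus_neg y = Ei_plus_ray (- pi) (exp (Ln y + \<i> * of_real pi))"
    unfolding Ei_plus_neg_def
    by (rule Ei_plus_eq_ray) (use assms Re_Ln_pos_lt[OF y0] in auto)
  also have "exp (Ln y + \<i> * of_real pi) = - y"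
    using y0 by (simp add: exp_add mult.commute[of \<i>])
  also have "Ei_plus_ray (- pi) (- y) = exp (- y) * laplace (\<lambda>t. - 1 * (1 / (1 + of_real t))) y"
    by (simp add: Ei_plus_ray_laplace ray_kernel_def[abs_def] cis_neg)
  finally show ?thesis
    by (simp only: laplace_cmult) (simp add: exp_minus)
qed

section \<open>Factorial series of the Lerch transcendent\<close>

text \<open>Substituting \<open>u = exp (- t)\<close> turns this into the Beta integral of \<open>u ^ (s - 1) * (1 - u) ^ m\<close> over \<open>(0, 1)\<close>.
  The induction uses \<open>(1 - u) ^ (m + 1) = (1 - u) ^ m - u (1 - u) ^ m\<close>, where the factor \<open>u\<close> shifts \<open>s\<close> by 1.\<close>

lemma laplace_beta:
  assumes "Re s > 0"
  shows "laplace (\<lambda>t. of_real ((1 - exp (- t)) ^ m)) s = fact m / pochhammer s (Suc m)"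
  using assms
proof (induction m arbitrary: s)
  case 0
  then show ?case using laplace_const[of s 1] by simp
next
  case (Suc m)
  let ?g = "\<lambda>t::real. complex_of_real ((1 - exp (- t)) ^ m)"
  have pow_le: "(1 - exp (- t)) ^ m \<le> 1" if "t \<ge> 0" for t :: real
    using that by (intro power_le_one) auto
  have int: "set_integrable lborel {0..} (\<lambda>t. exp (- (of_real t * s)) * ?g t)"
    by (rule laplace_integrable[where M = 1 and a = 0]) (use Suc.prems pow_le in \<open>auto simp del: of_real_power\<close>)
  have int': "set_integrable lborel {0..} (\<lambda>t. exp (- (of_real t * s)) * (of_real (exp (- t)) * ?g t))"
  proof (rule laplace_integrable[where M = 1 and a = 0])
    fix t :: real assume t: "t \<ge> 0"
    show "norm (of_real (exp (- t)) * ?g t) \<le> 1 * exp (0 * t)"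
      using t pow_le[OF t] by (simp add: norm_mult mult_le_one del: of_real_power)
  qed (use Suc.prems in auto)
  have nz: "s + of_nat j \<noteq> 0" for j
    using Suc.prems by (auto simp: complex_eq_iff)
  define Q where "Q = pochhammer s (Suc (Suc m))"
  have Q1: "Q = pochhammer s (Suc m) * (s + of_nat (Suc m))"
    unfolding Q_def by (rule pochhammer_Suc)
  have Q2: "Q = s * pochhammer (s + 1) (Suc m)"
    unfolding Q_def by (rule pochhammer_rec)
  have Q0: "Q \<noteq> 0" unfolding Q_def pochhammer_eq_0_iff using nz by (metis add.commute add.inverse_inverse add_eq_0_iff)
  have "laplace (\<lambda>t. of_real ((1 - exp (- t)) ^ Suc m)) s
      = laplace (\<lambda>t. ?g t - of_real (exp (- t)) * ?g t) s"
    by (rule laplace_cong) (simp add: algebra_simps)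
  also have "\<dots> = laplace ?g s - laplace ?g (s + 1)"
    by (simp only: laplace_diff[OF int int'] laplace_shift)
  also have "\<dots> = fact m / pochhammer s (Suc m) - fact m / pochhammer (s + 1) (Suc m)"
    using Suc.IH[of s] Suc.IH[of "s + 1"] Suc.prems by simp
  also have "fact m / pochhammer s (Suc m) = fact m * (s + of_nat (Suc m)) / Q"
    using nz[of "Suc m"] by (simp only: Q1 mult_divide_mult_cancel_right) simp
  also have "fact m / pochhammer (s + 1) (Suc m) = fact m * s / Q"
    using nz[of 0] by (simp add: Q2)
  also have "fact m * (s + of_nat (Suc m)) / Q - fact m * s / Q = fact (Suc m) / Q"
    by (simp add: field_simps diff_divide_distrib[symmetric])
  finally show ?case by (simp only: Q_def)
qed

lemma Lerch_Phi1_laplace: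
  "Lerch_Phi1 z s = laplace (\<lambda>t. 1 / (1 - z * of_real (exp (- t)))) s"
  by (simp add: Lerch_Phi1_def laplace_def mult.commute)

definition lerch_term :: "real \<Rightarrow> complex \<Rightarrow> nat \<Rightarrow> complex" where
  "lerch_term z s m = of_real ((- z) ^ m / (1 - z) ^ Suc m) * (fact m / pochhammer s (Suc m))"

lemma lerch_ratio_less_1:
  assumes "z < (1 / 2 :: real)"
  shows "\<bar>z / (1 - z)\<bar> < 1"
  using assms by (simp add: abs_if divide_simps)

text \<open>With \<open>u = exp (- t)\<close> and \<open>r = - z / (1 - z)\<close> one has \<open>1 - z u = (1 - z) (1 - r (1 - u))\<close>.  The transform
  \<open>R n\<close> of \<open>(r (1 - u)) ^ n / (1 - z u)\<close> is therefore the remainder after \<open>n\<close> terms, and it is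
  \<open>O(\<bar>r\<bar> ^ n)\<close>.\<close>

lemma lerch_term_sums:
  assumes z: "z < 1 / 2" and s: "Re s > 0"
  shows "lerch_term z s sums Lerch_Phi1 (of_real z) s"
proof -
  define r where "r = - z / (1 - z)"
  define R where "R n = laplace (\<lambda>t. of_real ((r * (1 - exp (- t))) ^ n / (1 - z * exp (- t)))) s" for n
  have den: "1 - z * exp (- t) \<ge> 1 / 2" if "t \<ge> 0" for t
  proof (cases "z \<ge> 0")
    case True
    then have "z * exp (- t) \<le> 1 / 2 * 1" using z that by (intro mult_mono) auto
    then show ?thesis by simp
  next
    case False
    then have "z * exp (- t) \<le> 0" by (simp add: mult_nonpos_nonneg)
    then show ?thesis by simp
  qed
  have r: "\<bar>r\<bar> < 1" using lerch_ratio_less_1[OF z] by (simp add: r_def)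
  have bound: "norm (complex_of_real ((r * (1 - exp (- t))) ^ n / (1 - z * exp (- t)))) \<le> (2 * \<bar>r\<bar> ^ n) * exp (0 * t)"
    if t: "t \<ge> 0" for t n
  proof -
    have "\<bar>r * (1 - exp (- t))\<bar> ^ n \<le> \<bar>r\<bar> ^ n"
      using t by (intro power_mono) (auto simp: abs_mult intro: mult_left_le)
    then have "\<bar>(r * (1 - exp (- t))) ^ n\<bar> / \<bar>1 - z * exp (- t)\<bar> \<le> \<bar>r\<bar> ^ n / (1 / 2)"
      using den[OF t] by (intro frac_le) (auto simp: power_abs)
    then show ?thesis by (simp only: norm_of_real abs_divide) simp
  qed
  have int: "set_integrable lborel {0..}
      (\<lambda>t. exp (- (of_real t * s)) * of_real ((r * (1 - exp (- t))) ^ n / (1 - z * exp (- t))))" for n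
    by (rule laplace_integrable[OF _ bound]) (use s in auto)
  have step: "R n - R (Suc n) = lerch_term z s n" for n
  proof -
    have "R n - R (Suc n) = laplace (\<lambda>t. of_real ((r * (1 - exp (- t))) ^ n / (1 - z * exp (- t)))
        - of_real ((r * (1 - exp (- t))) ^ Suc n / (1 - z * exp (- t)))) s"
      unfolding R_def by (rule laplace_diff[OF int int, symmetric])
    also have "\<dots> = laplace (\<lambda>t. of_real (r ^ n / (1 - z)) * of_real ((1 - exp (- t)) ^ n)) s"
    proof (rule laplace_cong)
      fix t :: real assume t: "t \<ge> 0"
      define u where "u = exp (- t)"
      have "1 - r * (1 - u) = (1 - z * u) / (1 - z)"
        using z by (simp add: r_def field_simps)
      moreover have "1 - z * u \<noteq> 0" using den[OF t] by (auto simp: u_def)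
      ultimately have "(r * (1 - u)) ^ n * (1 - r * (1 - u)) / (1 - z * u) = r ^ n / (1 - z) * (1 - u) ^ n"
        by (simp add: power_mult_distrib)
      then have "(r * (1 - u)) ^ n / (1 - z * u) - (r * (1 - u)) ^ Suc n / (1 - z * u) = r ^ n / (1 - z) * (1 - u) ^ n"
        by (simp add: diff_divide_distrib[symmetric] algebra_simps)
      then show "complex_of_real ((r * (1 - exp (- t))) ^ n / (1 - z * exp (- t)))
          - of_real ((r * (1 - exp (- t))) ^ Suc n / (1 - z * exp (- t)))
          = of_real (r ^ n / (1 - z)) * of_real ((1 - exp (- t)) ^ n)"
        unfolding u_def by (simp only: of_real_diff[symmetric] of_real_mult[symmetric])
    qed
    also have "\<dots> = of_real (r ^ n / (1 - z)) * (fact n / pochhammer s (Suc n))"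
      by (simp only: laplace_cmult laplace_beta[OF s])
    also have "r ^ n / (1 - z) = (- z) ^ n / (1 - z) ^ Suc n"
      by (simp only: r_def power_divide power_Suc divide_divide_eq_left mult.commute)
    finally show ?thesis by (simp only: lerch_term_def)
  qed
  have "R \<longlonglongrightarrow> 0"
  proof (rule Lim_null_comparison)
    show "\<forall>\<^sub>F n in sequentially. norm (R n) \<le> 2 * \<bar>r\<bar> ^ n / (Re s - 0)"
      unfolding R_def by (intro always_eventually allI norm_laplace_le[OF _ bound]) (use s in auto)
    have "(\<lambda>n. 2 * \<bar>r\<bar> ^ n / (Re s - 0)) \<longlonglongrightarrow> 2 * 0 / (Re s - 0)"
      by (intro tendsto_intros LIMSEQ_power_zero) (use r s in auto)
    then show "(\<lambda>n. 2 * \<bar>r\<bar> ^ n / (Re s - 0)) \<longlonglongrightarrow> 0" by simp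
  qed
  from telescope_sums'[OF this] have "lerch_term z s sums R 0"
    by (simp add: step)
  also have "R 0 = Lerch_Phi1 (of_real z) s"
    by (simp add: R_def Lerch_Phi1_laplace)
  finally show ?thesis .
qed

section \<open>Remainders of the factorial series\<close>

text \<open>In the right half-plane \<open>\<bar>s + j\<bar>\<close> is at least \<open>\<bar>s\<bar>\<close> and at least \<open>j\<close>.  The first bound is used for
  the factors with \<open>j \<le> n\<close> and the second for the others.  The result is uniform up to the imaginary
  axis, where the Beta integral of \<open>\<bar>u ^ (s - 1)\<bar>\<close> would diverge.\<close>

lemma norm_fact_over_pochhammer_le:
  assumes s: "Re s > 0" and "n \<le> m"
  shows "norm (fact m / pochhammer s (Suc m)) \<le> fact n / norm s ^ Suc n"
  using \<open>n \<le> m\<close>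
proof (induction m rule: dec_induct)
  case base
  have s0: "s \<noteq> 0" using s by auto
  have "norm s ^ Suc j \<le> norm (pochhammer s (Suc j))" for j
  proof (induction j)
    case (Suc j)
    have "norm s \<le> norm (s + of_nat (Suc j))"
      unfolding cmod_def using s
      by (intro real_sqrt_le_mono add_mono[OF power_mono]) auto
    then have "norm s ^ Suc j * norm s \<le> norm (pochhammer s (Suc j)) * norm (s + of_nat (Suc j))"
      using Suc by (intro mult_mono) auto
    then show ?case by (simp only: pochhammer_Suc[of s "Suc j"] norm_mult) (simp add: mult_ac)
  qed simp
  then show ?case
    using s0 by (auto simp: norm_divide simp del: pochhammer_Suc power_Suc intro!: frac_le)
next
  case (step m)
  have "real (Suc m) \<le> Re (s + of_nat (Suc m))" using s by simp
  also have "\<dots> \<le> norm (s + of_nat (Suc m))" by (rule complex_Re_le_cmod)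
  finally have "real (Suc m) / norm (s + of_nat (Suc m)) \<le> 1" by (auto simp: divide_le_eq_1)
  then have "norm (fact m / pochhammer s (Suc m)) * (real (Suc m) / norm (s + of_nat (Suc m)))
      \<le> norm (fact m / pochhammer s (Suc m)) * 1"
    by (intro mult_left_mono) auto
  also have "norm (fact m / pochhammer s (Suc m)) * (real (Suc m) / norm (s + of_nat (Suc m)))
      = norm (fact (Suc m) / pochhammer s (Suc (Suc m)))"
    by (simp only: pochhammer_Suc[of s "Suc m"] norm_divide norm_mult fact_Suc norm_of_nat of_nat_fact) (simp add: mult_ac)
  finally show ?case using step.IH by simp
qed

text \<open>\<open>m! m ^ s / (s)\<^sub>m\<^sub>+\<^sub>1\<close> converges to \<open>Gamma s\<close>, hence is bounded.\<close>

lemma fact_over_pochhammer_powr_bound: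
  assumes s: "Re s > 0"
  obtains A where "A > 0" "\<And>m. m \<ge> 1 \<Longrightarrow> norm (fact m / pochhammer s (Suc m)) \<le> A * real m powr (- Re s)"
proof -
  have "Bseq (Gamma_series s)"
    using Gamma_series_LIMSEQ by (blast intro: convergent_imp_Bseq convergentI)
  then obtain A where A: "A > 0" "\<And>n. norm (Gamma_series s n) \<le> A"
    by (auto simp: Bseq_def)
  show ?thesis
  proof (rule that[OF A(1)])
    fix m :: nat assume m: "m \<ge> 1"
    have "norm (Gamma_series s m) = norm (fact m / pochhammer s (Suc m)) * real m powr Re s"
      using m by (simp add: Gamma_series_def norm_divide norm_mult powr_def mult.commute)
    with A(2)[of m] have "norm (fact m / pochhammer s (Suc m)) * real m powr Re s \<le> A" by simp
    moreover have "real m powr Re s > 0" using m by simp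
    ultimately show "norm (fact m / pochhammer s (Suc m)) \<le> A * real m powr (- Re s)"
      by (simp add: powr_minus field_simps)
  qed
qed

lemma geometric_tail_le:
  fixes f :: "nat \<Rightarrow> 'a :: banach"
  assumes q: "0 \<le> q" "q < 1" and f: "\<And>m. m \<ge> n \<Longrightarrow> norm (f m) \<le> C * q ^ m"
  shows "norm (suminf f - sum f {..<n}) \<le> C * q ^ n / (1 - q)"
proof -
  have geo: "(\<lambda>m. C * q ^ n * q ^ m) sums (C * q ^ n * (1 / (1 - q)))"
    by (intro sums_mult geometric_sums) (use q in auto)
  have le: "norm (f (m + n)) \<le> C * q ^ n * q ^ m" for m
    using f[of "m + n"] by (simp add: power_add mult_ac)
  have sn: "summable (\<lambda>m. norm (f (m + n)))"
    by (rule summable_comparison_test[OF _ sums_summable[OF geo]]) (use le in auto)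
  then have sf: "summable f"
    using summable_norm_cancel summable_iff_shift by blast
  have "suminf f - sum f {..<n} = (\<Sum>m. f (m + n))"
    using suminf_minus_initial_segment[OF sf, of n] by simp
  also have "norm \<dots> \<le> (\<Sum>m. norm (f (m + n)))" by (rule summable_norm[OF sn])
  also have "\<dots> \<le> (\<Sum>m. C * q ^ n * q ^ m)"
    by (rule suminf_le[OF le sn sums_summable[OF geo]])
  also have "\<dots> = C * q ^ n / (1 - q)" using sums_unique[OF geo] by simp
  finally show ?thesis .
qed

lemma norm_lerch_term:
  assumes "z < 1"
  shows "norm (lerch_term z s m) = \<bar>z / (1 - z)\<bar> ^ m / (1 - z) * norm (fact m / pochhammer s (Suc m))"
  using assms unfolding lerch_term_def norm_mult norm_of_real
  by (simp add: abs_mult power_abs power_divide)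

lemma lerch_tail_le:
  assumes z: "z < 1 / 2"
    and B: "\<And>m. m \<ge> n \<Longrightarrow> norm (fact m / pochhammer s (Suc m)) \<le> B"
  shows "norm (suminf (lerch_term z s) - sum (lerch_term z s) {..<n})
      \<le> B / ((1 - z) * (1 - \<bar>z / (1 - z)\<bar>)) * \<bar>z / (1 - z)\<bar> ^ n"
proof -
  have "norm (suminf (lerch_term z s) - sum (lerch_term z s) {..<n})
      \<le> B / (1 - z) * \<bar>z / (1 - z)\<bar> ^ n / (1 - \<bar>z / (1 - z)\<bar>)"
  proof (rule geometric_tail_le)
    fix m assume "m \<ge> n"
    then have "\<bar>z / (1 - z)\<bar> ^ m / (1 - z) * norm (fact m / pochhammer s (Suc m)) \<le> \<bar>z / (1 - z)\<bar> ^ m / (1 - z) * B"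
      using z by (intro mult_left_mono B) auto
    then show "norm (lerch_term z s m) \<le> B / (1 - z) * \<bar>z / (1 - z)\<bar> ^ m"
      using z by (subst norm_lerch_term) (auto simp: mult_ac)
  qed (use lerch_ratio_less_1[OF z] in auto)
  then show ?thesis by (simp add: mult_ac)
qed

lemma lerch_tail_bigo:
  assumes z: "z < 1 / 2" and s: "Re s > 0"
  shows "(\<lambda>n. norm (suminf (lerch_term z s) - sum (lerch_term z s) {..<n}))
    \<in> O(\<lambda>n. \<bar>z / (1 - z)\<bar> ^ n * real n powr (- Re s))"
proof -
  obtain A where A: "A > 0" "\<And>m. m \<ge> 1 \<Longrightarrow> norm (fact m / pochhammer s (Suc m)) \<le> A * real m powr (- Re s)"
    using fact_over_pochhammer_powr_bound[OF s] by blast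
  define K where "K = A / ((1 - z) * (1 - \<bar>z / (1 - z)\<bar>))"
  show ?thesis
  proof (rule bigoI[where c = K], rule eventually_mono[OF eventually_ge_at_top[of 1]])
    fix n :: nat assume n: "n \<ge> 1"
    have "norm (suminf (lerch_term z s) - sum (lerch_term z s) {..<n})
      \<le> (A * real n powr (- Re s)) / ((1 - z) * (1 - \<bar>z / (1 - z)\<bar>)) * \<bar>z / (1 - z)\<bar> ^ n"
    proof (rule lerch_tail_le[OF z])
      fix m assume m: "m \<ge> n"
      have "real m powr (- Re s) \<le> real n powr (- Re s)"
        using s n m by (intro powr_mono2') auto
      then show "norm (fact m / pochhammer s (Suc m)) \<le> A * real n powr (- Re s)"
        using A(2)[of m] A(1) n m by (smt (verit) mult_left_mono le_trans)
    qed
    also have "\<dots> = K * (\<bar>z / (1 - z)\<bar> ^ n * real n powr (- Re s))" by (simp add: K_def mult_ac)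
    finally show "norm (norm (suminf (lerch_term z s) - sum (lerch_term z s) {..<n}))
      \<le> K * norm (\<bar>z / (1 - z)\<bar> ^ n * real n powr (- Re s))"
      by (simp add: abs_mult power_abs)
  qed
qed

text \<open>The bound gives one power of \<open>1 / \<bar>s\<bar>\<close> more than the estimates \<open>O(s ^ (- n))\<close> of the theorem; for
  \<open>n = 0\<close> the extra power makes the sum over \<open>k\<close> at \<open>s = 2 ^ k y\<close> converge geometrically.\<close>

lemma lerch_tail_uniform:
  assumes z: "z < 1 / 2" and s: "Re s > 0"
  shows "norm (suminf (lerch_term z s) - sum (lerch_term z s) {..<n})
    \<le> fact n / ((1 - z) * (1 - \<bar>z / (1 - z)\<bar>)) / norm s ^ Suc n"
proof -
  let ?q = "\<bar>z / (1 - z)\<bar>"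
  have q: "?q < 1" by (rule lerch_ratio_less_1[OF z])
  have "norm (suminf (lerch_term z s) - sum (lerch_term z s) {..<n})
      \<le> (fact n / norm s ^ Suc n) / ((1 - z) * (1 - ?q)) * ?q ^ n"
    by (rule lerch_tail_le[OF z norm_fact_over_pochhammer_le[OF s]])
  also have "\<dots> \<le> (fact n / norm s ^ Suc n) / ((1 - z) * (1 - ?q)) * 1"
    using q z by (intro mult_left_mono power_le_one divide_nonneg_nonneg mult_nonneg_nonneg) auto
  finally show ?thesis by (simp add: mult_ac)
qed

section \<open>The dyadic decomposition\<close>

text \<open>Up to the scale, this is the error after \<open>n\<close> steps of the dyadic decomposition of \<open>1 / v\<close>:
  \<open>1 / (1 - exp (- v)) - (\<Sum>k=1..n. 2\<^sup>-\<^sup>k / (1 + exp (- v / 2 ^ k))) - 1 / v\<close> equals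
  \<open>dyadic_defect (v / 2 ^ n) / 2 ^ n\<close>.\<close>

definition dyadic_defect :: "real \<Rightarrow> real" where
  "dyadic_defect v = 1 / (1 - exp (- v)) - 1 / v"

lemma dyadic_defect_bounds:
  assumes "v > 0"
  shows "0 \<le> dyadic_defect v" "dyadic_defect v \<le> 1"
proof -
  have pos: "1 - exp (- v) > 0" using assms by simp
  have "1 - exp (- v) \<le> v" using exp_ge_add_one_self[of "- v"] by simp
  then show "0 \<le> dyadic_defect v"
    using pos assms by (simp add: dyadic_defect_def frac_le)
  have "exp (- v) * (1 + v) \<le> exp (- v) * exp v"
    by (intro mult_left_mono exp_ge_add_one_self) auto
  then have "(1 + v) * exp (- v) \<le> 1" by (simp add: exp_minus mult_ac)
  then have "v \<le> (1 + v) * (1 - exp (- v))" by (simp add: algebra_simps)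
  then show "dyadic_defect v \<le> 1"
    using pos assms by (simp add: dyadic_defect_def field_simps)
qed

text \<open>The partial fraction \<open>2 / (1 - q\<^sup>2) = 1 / (1 - q) + 1 / (1 + q)\<close> at \<open>q = exp (- w)\<close>; the polar terms
  \<open>2 / (2 w)\<close> and \<open>1 / w\<close> cancel.\<close>

lemma dyadic_defect_half:
  assumes "w > 0"
  shows "2 * dyadic_defect (2 * w) - dyadic_defect w = 1 / (1 + exp (- w))"
proof -
  define q where "q = exp (- w)"
  have q: "0 < q" "q < 1" using assms by (auto simp: q_def)
  have "exp (- (2 * w)) = q * q" by (simp add: q_def exp_add[symmetric])
  moreover have "1 - q * q = (1 - q) * (1 + q)" by (simp add: algebra_simps)
  moreover have "2 / ((1 - q) * (1 + q)) - 1 / (1 - q) = 1 / (1 + q)"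
  proof -
    have "1 / (1 - q) = (1 + q) / ((1 - q) * (1 + q))" using q by simp
    then have "2 / ((1 - q) * (1 + q)) - 1 / (1 - q) = (1 - q) / ((1 - q) * (1 + q))"
      by (simp only: diff_divide_distrib[symmetric]) simp
    then show ?thesis using q by simp
  qed
  ultimately show ?thesis
    using assms by (simp add: dyadic_defect_def q_def[symmetric])
qed

lemma Lerch_Phi1_rescaled:
  "Lerch_Phi1 (- exp (- (1 / 2 ^ k))) (2 ^ k * y)
    = laplace (\<lambda>t. of_real (1 / 2 ^ k * (1 / (1 + exp (- ((1 + t) / 2 ^ k)))))) y"
proof -
  define a where "a = (2::real) ^ k"
  have a: "a > 0" by (simp add: a_def)
  define g where "g u = complex_of_real (1 / (1 + exp (- (1 / a)) * exp (- u)))" for u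
  have ca: "complex_of_real a = 2 ^ k" by (simp add: a_def)
  have "Lerch_Phi1 (- exp (- (1 / 2 ^ k))) (2 ^ k * y) = laplace g (of_real a * y)"
    by (simp add: Lerch_Phi1_laplace g_def[abs_def] ca[symmetric] exp_of_real[symmetric])
  also have "\<dots> = of_real (1 / a) * laplace (\<lambda>t. g (t / a)) y"
    using a by (simp add: laplace_scale)
  also have "\<dots> = laplace (\<lambda>t. of_real (1 / a) * g (t / a)) y"
    by (rule laplace_cmult[symmetric])
  also have "(\<lambda>t. of_real (1 / a) * g (t / a)) = (\<lambda>t. of_real (1 / a * (1 / (1 + exp (- ((1 + t) / a))))))"
    by (simp add: g_def add_divide_distrib exp_add[symmetric])
  finally show ?thesis unfolding a_def .
qed

text \<open>The transforms \<open>T n\<close> of the errors of the dyadic decomposition at \<open>v = 1 + t\<close> telescope to the Lerch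
  transcendents and are \<open>O(2\<^sup>-\<^sup>n)\<close>, since the defect is bounded.\<close>

lemma dyadic_Lerch_sums:
  assumes y: "Re y > 0"
  shows "(\<lambda>k. Lerch_Phi1 (- exp (- (1 / 2 ^ Suc k))) (2 ^ Suc k * y)) sums
    (Lerch_Phi1 (exp (- 1)) y - laplace (\<lambda>t. 1 / (1 + of_real t)) y)"
proof -
  have halve: "1 / 2 ^ n * A - 1 / 2 ^ Suc n * B = 1 / 2 ^ Suc n * C" if "2 * A - B = C" for A B C :: real and n
    using that by (auto simp: field_simps)
  define T where "T n = laplace (\<lambda>t. of_real (1 / 2 ^ n * dyadic_defect ((1 + t) / 2 ^ n))) y" for n
  have [measurable]: "dyadic_defect \<in> borel_measurable borel"
    unfolding dyadic_defect_def by measurable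
  have bound: "norm (complex_of_real (1 / 2 ^ n * dyadic_defect ((1 + t) / 2 ^ n))) \<le> (1 / 2) ^ n * exp (0 * t)"
    if "t \<ge> 0" for t n
    using dyadic_defect_bounds[of "(1 + t) / 2 ^ n"] that
    by (simp only: norm_of_real) (simp add: power_one_over divide_right_mono)
  have int: "set_integrable lborel {0..}
      (\<lambda>t. exp (- (of_real t * y)) * of_real (1 / 2 ^ n * dyadic_defect ((1 + t) / 2 ^ n)))" for n
    by (rule laplace_integrable[OF _ bound]) (use y in auto)
  have step: "T n - T (Suc n) = Lerch_Phi1 (- exp (- (1 / 2 ^ Suc n))) (2 ^ Suc n * y)" for n
  proof -
    have "T n - T (Suc n) = laplace (\<lambda>t. of_real (1 / 2 ^ n * dyadic_defect ((1 + t) / 2 ^ n))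
        - of_real (1 / 2 ^ Suc n * dyadic_defect ((1 + t) / 2 ^ Suc n))) y"
      unfolding T_def by (rule laplace_diff[OF int int, symmetric])
    also have "\<dots> = laplace (\<lambda>t. of_real (1 / 2 ^ Suc n * (1 / (1 + exp (- ((1 + t) / 2 ^ Suc n)))))) y"
    proof (rule laplace_cong)
      fix t :: real assume "t \<ge> 0"
      then have "2 * dyadic_defect (2 * ((1 + t) / 2 ^ Suc n)) - dyadic_defect ((1 + t) / 2 ^ Suc n)
          = 1 / (1 + exp (- ((1 + t) / 2 ^ Suc n)))"
        by (intro dyadic_defect_half) auto
      also have "2 * ((1 + t) / 2 ^ Suc n) = (1 + t) / 2 ^ n" by (simp add: field_simps)
      finally have "1 / 2 ^ n * dyadic_defect ((1 + t) / 2 ^ n) - 1 / 2 ^ Suc n * dyadic_defect ((1 + t) / 2 ^ Suc n)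
          = 1 / 2 ^ Suc n * (1 / (1 + exp (- ((1 + t) / 2 ^ Suc n))))"
        by (rule halve)
      then show "complex_of_real (1 / 2 ^ n * dyadic_defect ((1 + t) / 2 ^ n))
        - of_real (1 / 2 ^ Suc n * dyadic_defect ((1 + t) / 2 ^ Suc n))
        = of_real (1 / 2 ^ Suc n * (1 / (1 + exp (- ((1 + t) / 2 ^ Suc n)))))"
        by (simp only: of_real_diff[symmetric])
    qed
    finally show ?thesis by (simp only: Lerch_Phi1_rescaled)
  qed
  have "T \<longlonglongrightarrow> 0"
  proof (rule Lim_null_comparison)
    show "\<forall>\<^sub>F n in sequentially. norm (T n) \<le> (1 / 2) ^ n / (Re y - 0)"
      unfolding T_def by (intro always_eventually allI norm_laplace_le[OF _ bound]) (use y in auto)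
    have "(\<lambda>n. (1 / 2) ^ n / (Re y - 0)) \<longlonglongrightarrow> 0 / (Re y - 0)"
      by (intro tendsto_intros LIMSEQ_power_zero) (use y in auto)
    then show "(\<lambda>n. (1 / 2) ^ n / (Re y - 0)) \<longlonglongrightarrow> 0" by simp
  qed
  from telescope_sums'[OF this]
  have "(\<lambda>k. Lerch_Phi1 (- exp (- (1 / 2 ^ Suc k))) (2 ^ Suc k * y)) sums T 0"
    by (simp only: step) simp
  also have "T 0 = Lerch_Phi1 (exp (- 1)) y - laplace (\<lambda>t. 1 / (1 + of_real t)) y"
  proof -
    have i2: "set_integrable lborel {0..} (\<lambda>t. exp (- (of_real t * y)) * (1 / (1 + of_real t)))"
    proof (rule laplace_integrable[where M = 1 and a = 0])
      fix t :: real assume t: "t \<ge> 0"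
      have "1 / (1 + complex_of_real t) = of_real (1 / (1 + t))" by simp
      then have "norm (1 / (1 + complex_of_real t)) = 1 / (1 + t)"
        using t by (simp only: norm_of_real) simp
      then show "norm (1 / (1 + complex_of_real t)) \<le> 1 * exp (0 * t)"
        using t by simp
    qed (use y in auto)
    have split: "1 / (1 - exp (- 1) * of_real (exp (- t)))
        = complex_of_real (1 / 2 ^ 0 * dyadic_defect ((1 + t) / 2 ^ 0)) + 1 / (1 + of_real t)" for t
    proof -
      have "exp (- 1) * complex_of_real (exp (- t)) = of_real (exp (- (1 + t)))"
        by (simp add: exp_of_real[symmetric] exp_add[symmetric])
      then show ?thesis by (simp add: dyadic_defect_def)
    qed
    have "Lerch_Phi1 (exp (- 1)) y = T 0 + laplace (\<lambda>t. 1 / (1 + of_real t)) y"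
      unfolding Lerch_Phi1_laplace split T_def by (rule laplace_add[OF int i2])
    then show ?thesis by simp
  qed
  finally show ?thesis .
qed

lemma Ei_plus_neg_Lerch:
  assumes "Re y > 0"
  shows "exp y * Ei_plus_neg y = - (Lerch_Phi1 (exp (- 1)) y
     - (\<Sum>k. Lerch_Phi1 (- exp (- (1 / 2 ^ Suc k))) (2 ^ Suc k * y)))"
  by (simp only: sums_unique[OF dyadic_Lerch_sums[OF assms], symmetric] Ei_plus_neg_laplace[OF assms]) simp

section \<open>The two families of factorial series\<close>

lemma term0_eq_lerch_term: "term0 (Suc m) y = lerch_term (exp (- 1)) y m"
proof -
  have e: "1 - exp (- 1) = (exp 1 - 1) / exp (1::real)" by (simp add: exp_minus field_simps)
  have num: "(- exp (- 1)) ^ m = (- 1) ^ m / exp (1::real) ^ m"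
    by (simp add: exp_minus divide_inverse power_inverse[symmetric] flip: power_mult_distrib)
  have "(- exp (- 1)) ^ m / (1 - exp (- 1)) ^ Suc m = (- 1) ^ m * exp 1 / (exp 1 - 1 :: real) ^ Suc m"
    unfolding e num power_divide by simp
  then have "lerch_term (exp (- 1)) y m
     = of_real ((- 1) ^ m * exp 1 / (exp 1 - 1) ^ Suc m) * (fact m / pochhammer y (Suc m))"
    by (simp only: lerch_term_def)
  also have "\<dots> = term0 (Suc m) y"
    unfolding term0_def
    by (simp add: exp_of_real[symmetric] Gamma_fact)
  finally show ?thesis ..
qed

definition dyadic_base :: "nat \<Rightarrow> real" where
  "dyadic_base k = - exp (- (1 / 2 ^ k))"

lemma termk_eq_lerch_term: "termk k (Suc m) y = lerch_term (dyadic_base k) (2 ^ k * y) m"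
proof -
  define b where "b = (1::real) / 2 ^ k"
  have cb: "complex_of_real b = 1 / 2 ^ k" by (simp add: b_def)
  have e: "1 + exp (- b) = (exp b + 1) / exp b" by (simp add: exp_minus field_simps)
  have "exp (- b) ^ m / (1 + exp (- b)) ^ Suc m = exp b / (exp b + 1) ^ Suc m"
    unfolding e power_divide exp_minus by (simp add: power_inverse field_simps)
  then have "lerch_term (dyadic_base k) (2 ^ k * y) m
     = of_real (exp b / (exp b + 1) ^ Suc m) * (fact m / pochhammer (2 ^ k * y) (Suc m))"
    by (simp add: lerch_term_def dyadic_base_def b_def[symmetric])
  also have "\<dots> = termk k (Suc m) y"
    unfolding termk_def cb[symmetric]
    by (simp add: exp_of_real[symmetric] Gamma_fact)
  finally show ?thesis ..
qed

lemma dyadic_base_less: "dyadic_base k < 1 / 2"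
proof -
  have "0 < exp (- (1 / 2 ^ k) :: real)" by simp
  then show ?thesis unfolding dyadic_base_def by linarith
qed

lemma dyadic_base_ratio: "\<bar>dyadic_base k / (1 - dyadic_base k)\<bar> = 1 / (exp (1 / 2 ^ k) + 1)"
proof -
  define E :: real where "E = exp (1 / 2 ^ k)"
  have E: "E > 0" and base: "dyadic_base k = - (1 / E)"
    by (simp_all add: E_def dyadic_base_def exp_minus divide_inverse)
  have "dyadic_base k / (1 - dyadic_base k) = - (1 / (E + 1))"
    unfolding base using E by (simp add: field_simps)
  then show ?thesis using E by (simp add: E_def)
qed

text \<open>For \<open>z < 0\<close> the constant \<open>(1 - z) (1 - \<bar>z / (1 - z)\<bar>)\<close> of the tail estimates equals 1, which is why they are
  uniform in \<open>k\<close>.\<close>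

lemma dyadic_base_const: "(1 - dyadic_base k) * (1 - \<bar>dyadic_base k / (1 - dyadic_base k)\<bar>) = 1"
proof -
  define E :: real where "E = exp (1 / 2 ^ k)"
  have E: "E > 0" and base: "dyadic_base k = - (1 / E)"
    by (simp_all add: E_def dyadic_base_def exp_minus divide_inverse)
  have "1 - - (1 / E) = (E + 1) / E" "1 - 1 / (E + 1) = E / (E + 1)"
    using E by (simp_all add: field_simps)
  then have "(1 - - (1 / E)) * (1 - 1 / (E + 1)) = 1"
    using E by simp
  then show ?thesis unfolding dyadic_base_ratio by (simp only: base E_def)
qed

lemma exp_neg_one_ratio: "\<bar>exp (- 1) / (1 - exp (- 1))\<bar> = 1 / (exp 1 - 1 :: real)"
proof -
  define E :: real where "E = exp 1"
  have E: "E > 1" by (simp add: E_def)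
  have "exp (- 1 :: real) = 1 / E" by (simp add: E_def exp_minus divide_inverse)
  moreover have "(1 / E) / (1 - 1 / E) = 1 / (E - 1)" using E by (simp add: field_simps)
  ultimately show ?thesis using E by (simp add: E_def)
qed
lemma exp_neg_one_less_half: "exp (- 1) < (1 / 2 :: real)"
proof -
  have "1 + 1 + 1\<^sup>2 / 2 \<le> exp (1::real)" by (rule exp_lower_Taylor_quadratic) simp
  then have "inverse (exp (1::real)) < inverse 2" by (intro less_imp_inverse_less) auto
  then show ?thesis by (simp add: exp_minus)
qed

lemma Re_two_power_mult: "Re (2 ^ k * y) = 2 ^ k * Re y"
proof -
  have "2 ^ k * y = of_real (2 ^ k) * y" by simp
  then show ?thesis by (simp only: Re_complex_of_real Im_complex_of_real times_complex.sel mult_zero_left diff_zero)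
qed

lemma seriesk_eq_Lerch:
  assumes "Re y > 0"
  shows "seriesk k y = Lerch_Phi1 (- exp (- (1 / 2 ^ k))) (2 ^ k * y)"
proof -
  have "Re (2 ^ k * y) > 0"
    using assms by (simp only: Re_two_power_mult) simp
  from sums_unique[OF lerch_term_sums[OF dyadic_base_less this]]
  show ?thesis
    by (simp add: seriesk_def termk_eq_lerch_term dyadic_base_def exp_of_real[symmetric])
qed

lemma rho0_eq: "rho0 n y = suminf (lerch_term (exp (- 1)) y) - sum (lerch_term (exp (- 1)) y) {..<n}"
  by (simp add: rho0_def series0_def term0_eq_lerch_term sum.atLeast1_atMost_eq)

lemma rhok_eq: "rhok l k y = suminf (lerch_term (dyadic_base k) (2 ^ k * y))
    - sum (lerch_term (dyadic_base k) (2 ^ k * y)) {..<l}"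
  by (simp add: rhok_def seriesk_def termk_eq_lerch_term sum.atLeast1_atMost_eq)

lemma norm_seriesk_le:
  assumes "Re y > 0"
  shows "norm (seriesk k y) \<le> 1 / norm y * (1 / 2) ^ k"
proof -
  have "Re (2 ^ k * y) > 0"
    using assms by (simp only: Re_two_power_mult) simp
  from lerch_tail_uniform[OF dyadic_base_less this, of k 0, unfolded dyadic_base_const]
  show ?thesis
    by (simp add: seriesk_def termk_eq_lerch_term norm_mult norm_power power_one_over mult.commute)
qed

text \<open>The bound decreases like \<open>1 / \<bar>y\<bar>\<close>, and \<open>\<bar>y\<bar>\<close> dominates \<open>Re y\<close>, \<open>Im y\<close> and \<open>- Im y\<close> alike; the three
  estimates of \<open>RN\<close> in the theorem are instances of this one, with \<open>c0 = 1\<close>.\<close>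

lemma norm_RN_le:
  assumes y: "Re y > 0" and N: "N \<ge> 1"
  shows "norm (RN N y) \<le> 1 / (2 ^ (N - 1) * norm y)"
proof -
  obtain n where n: "N = Suc n" using N by (cases N) auto
  have "(\<Sum>k=1..<N. seriesk k y) = (\<Sum>k<n. seriesk (Suc k) y)"
    unfolding n by (simp only: One_nat_def sum.shift_bounds_Suc_ivl atLeast0LessThan)
  then have "RN N y = suminf (\<lambda>k. seriesk (Suc k) y) - (\<Sum>k<n. seriesk (Suc k) y)"
    by (simp add: RN_def)
  also have "norm \<dots> \<le> 1 / norm y / 2 * (1 / 2) ^ n / (1 - 1 / 2)"
  proof (rule geometric_tail_le)
    show "norm (seriesk (Suc m) y) \<le> 1 / norm y / 2 * (1 / 2) ^ m" for m
      using norm_seriesk_le[OF y, of "Suc m"] by simp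
  qed auto
  also have "\<dots> = 1 / (2 ^ (N - 1) * norm y)" by (simp add: n power_one_over)
  finally show ?thesis .
qed

lemma RN_component_bound:
  assumes y: "Re y > 0" and c: "0 < c" "c < r" and r: "r \<le> norm y"
  shows "\<forall>\<^sub>F N in sequentially. norm (RN N y) \<le> 1 / (1 * 2 ^ (N - 1) * r)"
proof (rule eventually_mono[OF eventually_ge_at_top[of 1]])
  fix N :: nat assume "N \<ge> 1"
  then have "norm (RN N y) \<le> 1 / (2 ^ (N - 1) * norm y)" by (rule norm_RN_le[OF y])
  also have "\<dots> \<le> 1 / (1 * 2 ^ (N - 1) * r)"
    using c r by (intro divide_left_mono mult_mono mult_pos_pos) auto
  finally show "norm (RN N y) \<le> 1 / (1 * 2 ^ (N - 1) * r)" .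
qed

lemma lerch_tail_le_of_norm_ge_1:
  assumes z: "z < 1 / 2" and s: "Re s > 0" and large: "norm s \<ge> 1"
  shows "norm (suminf (lerch_term z s) - sum (lerch_term z s) {..<n})
    \<le> fact n / ((1 - z) * (1 - \<bar>z / (1 - z)\<bar>)) / norm s ^ n"
proof -
  define K where "K = fact n / ((1 - z) * (1 - \<bar>z / (1 - z)\<bar>))"
  have "K \<ge> 0"
    unfolding K_def using z lerch_ratio_less_1[OF z]
    by (intro divide_nonneg_nonneg mult_nonneg_nonneg) auto
  moreover have "norm s ^ n \<le> norm s ^ Suc n"
    using large by (intro power_increasing) auto
  moreover have "norm s ^ n > 0" using large by (intro zero_less_power) linarith
  ultimately have "K / norm s ^ Suc n \<le> K / norm s ^ n"
    by (intro frac_le) auto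
  with lerch_tail_uniform[OF z s, of n] show ?thesis
    unfolding K_def by (rule order_trans)
qed

lemma norm_rho0_le:
  assumes "Re y > 0" "norm y \<ge> 1"
  shows "norm (rho0 n y)
    \<le> fact n / ((1 - exp (- 1)) * (1 - \<bar>exp (- 1) / (1 - exp (- 1))\<bar>)) / norm y ^ n"
  unfolding rho0_eq by (rule lerch_tail_le_of_norm_ge_1[OF exp_neg_one_less_half assms])

lemma norm_rhok_le:
  assumes "Re y > 0" "norm (2 ^ k * y) \<ge> 1"
  shows "norm (rhok l k y) \<le> fact l / norm (2 ^ k * y) ^ l"
proof -
  have "Re (2 ^ k * y) > 0"
    using assms by (simp only: Re_two_power_mult) simp
  from lerch_tail_le_of_norm_ge_1[OF dyadic_base_less this assms(2), of k l]
  show ?thesis by (simp only: rhok_eq dyadic_base_const div_by_1)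
qed

theorem proposition18:
  shows
    "(\<forall>y\<in>sector.
        summable (\<lambda>m. term0 (Suc m) y) \<and>
        (\<forall>k\<ge>1. summable (\<lambda>m. termk k (Suc m) y)) \<and>
        summable (\<lambda>k. \<Sum>m. termk (Suc k) (Suc m) y) \<and>
        exp y * Ei_plus_neg y =
          - ((\<Sum>m. term0 (Suc m) y) - (\<Sum>k. \<Sum>m. termk (Suc k) (Suc m) y))) \<and>
     (\<forall>y\<in>sector.
        summable (\<lambda>k. Lerch_Phi1 (- exp (- (1 / 2 ^ Suc k))) (2 ^ Suc k * y)) \<and>
        exp y * Ei_plus_neg y =
          - (Lerch_Phi1 (exp (- 1)) y
             - (\<Sum>k. Lerch_Phi1 (- exp (- (1 / 2 ^ Suc k))) (2 ^ Suc k * y)))) \<and>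
     (\<forall>y\<in>sector.
        (\<lambda>n. norm (rho0 n y)) \<in> O(\<lambda>n. (1 / (exp 1 - 1)) ^ n * real n powr (- Re y))) \<and>
     (\<forall>n. \<exists>C B. \<forall>y\<in>sector. norm y \<ge> B \<longrightarrow> norm (rho0 n y) \<le> C / norm y ^ n) \<and>
     (\<forall>k\<ge>1. \<forall>y\<in>sector.
        (\<lambda>l. norm (rhok l k y)) \<in>
          O(\<lambda>l. (1 / (exp (1 / 2 ^ k) + 1)) ^ l * real l powr (- (2 ^ k * Re y)))) \<and>
     (\<forall>l. \<exists>C B. \<forall>k\<ge>1. \<forall>y\<in>sector.
        norm (2 ^ k * y) \<ge> B \<longrightarrow> norm (rhok l k y) \<le> C / norm (2 ^ k * y) ^ l) \<and>
     (\<forall>c>0. \<exists>c0>0. \<forall>y\<in>sector.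
        (Re y > c \<longrightarrow>
           (\<forall>\<^sub>F N in sequentially. norm (RN N y) \<le> 1 / (c0 * 2 ^ (N - 1) * Re y))) \<and>
        (Im y > c \<longrightarrow>
           (\<forall>\<^sub>F N in sequentially. norm (RN N y) \<le> 1 / (c0 * 2 ^ (N - 1) * Im y))) \<and>
        (- Im y > c \<longrightarrow>
           (\<forall>\<^sub>F N in sequentially. norm (RN N y) \<le> 1 / (c0 * 2 ^ (N - 1) * (- Im y)))))"
proof (intro conjI ballI allI impI)
  fix y assume "y \<in> sector"
  then have y: "Re y > 0" by (simp add: sector_iff)
  have scaled_pos: "Re (2 ^ k * y) > 0" for k using y by (simp add: Re_two_power_mult)
  have L0: "(\<lambda>m. term0 (Suc m) y) sums Lerch_Phi1 (exp (- 1)) y"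
    using lerch_term_sums[OF exp_neg_one_less_half y]
    by (simp add: term0_eq_lerch_term[abs_def] exp_of_real[symmetric])
  have Lk: "(\<Sum>m. termk k (Suc m) y) = Lerch_Phi1 (- exp (- (1 / 2 ^ k))) (2 ^ k * y)" for k
    using seriesk_eq_Lerch[OF y, of k] by (simp only: seriesk_def)
  show "summable (\<lambda>m. term0 (Suc m) y)" using L0 by (rule sums_summable)
  show "summable (\<lambda>m. termk k (Suc m) y)" for k
    using sums_summable[OF lerch_term_sums[OF dyadic_base_less scaled_pos]]
    by (simp only: termk_eq_lerch_term)
  show "summable (\<lambda>k. \<Sum>m. termk (Suc k) (Suc m) y)"
    unfolding Lk using dyadic_Lerch_sums[OF y] by (rule sums_summable)
  show "exp y * Ei_plus_neg y = - ((\<Sum>m. term0 (Suc m) y) - (\<Sum>k. \<Sum>m. termk (Suc k) (Suc m) y))"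
    unfolding Lk sums_unique[OF L0, symmetric] by (rule Ei_plus_neg_Lerch[OF y])
  show "summable (\<lambda>k. Lerch_Phi1 (- exp (- (1 / 2 ^ Suc k))) (2 ^ Suc k * y))"
    using dyadic_Lerch_sums[OF y] by (rule sums_summable)
  show "exp y * Ei_plus_neg y = - (Lerch_Phi1 (exp (- 1)) y
      - (\<Sum>k. Lerch_Phi1 (- exp (- (1 / 2 ^ Suc k))) (2 ^ Suc k * y)))"
    by (rule Ei_plus_neg_Lerch[OF y])
  show "(\<lambda>n. norm (rho0 n y)) \<in> O(\<lambda>n. (1 / (exp 1 - 1)) ^ n * real n powr (- Re y))"
    using lerch_tail_bigo[OF exp_neg_one_less_half y] by (simp only: rho0_eq exp_neg_one_ratio)
  show "(\<lambda>l. norm (rhok l k y)) \<in>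
      O(\<lambda>l. (1 / (exp (1 / 2 ^ k) + 1)) ^ l * real l powr (- (2 ^ k * Re y)))" for k
    using lerch_tail_bigo[OF dyadic_base_less scaled_pos, of k k]
    by (simp only: rhok_eq dyadic_base_ratio Re_two_power_mult)
next
  show "\<exists>C B. \<forall>y\<in>sector. norm y \<ge> B \<longrightarrow> norm (rho0 n y) \<le> C / norm y ^ n" for n
    unfolding sector_iff Ball_def by (rule exI, rule exI[of _ 1]) (blast intro: norm_rho0_le)
  show "\<exists>C B. \<forall>k\<ge>1. \<forall>y\<in>sector.
      norm (2 ^ k * y) \<ge> B \<longrightarrow> norm (rhok l k y) \<le> C / norm (2 ^ k * y) ^ l" for l
    unfolding sector_iff Ball_def by (rule exI, rule exI[of _ 1]) (blast intro: norm_rhok_le)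
next
  show "\<exists>c0>0. \<forall>y\<in>sector.
        (Re y > c \<longrightarrow>
           (\<forall>\<^sub>F N in sequentially. norm (RN N y) \<le> 1 / (c0 * 2 ^ (N - 1) * Re y))) \<and>
        (Im y > c \<longrightarrow>
           (\<forall>\<^sub>F N in sequentially. norm (RN N y) \<le> 1 / (c0 * 2 ^ (N - 1) * Im y))) \<and>
        (- Im y > c \<longrightarrow>
           (\<forall>\<^sub>F N in sequentially. norm (RN N y) \<le> 1 / (c0 * 2 ^ (N - 1) * (- Im y))))"
    if "c > 0" for c
  proof (rule exI[of _ 1], intro conjI ballI impI)
    fix y assume "y \<in> sector"
    then have y: "Re y > 0" by (simp add: sector_iff)
    note bound = RN_component_bound[OF y \<open>c > 0\<close>]
    show "\<forall>\<^sub>F N in sequentially. norm (RN N y) \<le> 1 / (1 * 2 ^ (N - 1) * Re y)" if "Re y > c"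
      using that complex_Re_le_cmod by (rule bound)
    show "\<forall>\<^sub>F N in sequentially. norm (RN N y) \<le> 1 / (1 * 2 ^ (N - 1) * Im y)" if "Im y > c"
      using that abs_Im_le_cmod[of y] by (intro bound) auto
    show "\<forall>\<^sub>F N in sequentially. norm (RN N y) \<le> 1 / (1 * 2 ^ (N - 1) * (- Im y))" if "- Im y > c"
      using that abs_Im_le_cmod[of y] by (intro bound) auto
  qed simp
qed

end
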